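(* Hoffman's exponential restricts to a map $\Phi_{\mathrm H}:D\to\mathsf{D}$ that is a tortkara morphism, i.e., for all $\varphi,\psi\in D$, $$\Phi_{\mathrm H}(\mathrm{area}(\varphi,\psi))=\mathtt{area}(\Phi_{\mathrm H}(\varphi),\Phi_{\mathrm H}(\psi)).$$
   Context: $\mathbb{F}$ is a field of characteristic zero, $d\ge1$. Words. $A=\{1,\dots,d\}$ is a set of $d$ letters, and $\mathfrak{A}$ is the free commutative semigroup (without unit) generated by $A$; its product is written $[ab]=[ba]$, iterated products are written $[a_1\cdots a_p]$, and $[a]:=a$ for $a\in\mathfrak{A}$. $T(\mathfrak{A})$ is the tensor algebra over the $\mathbb{F}$-vector space with basis $\mathfrak{A}$; its basis consists of the words $w=w_1\cdots w_k$, $w_i\in\mathfrak{A}$, including the empty word $e$; $\ell(w)=k$ is the length. Products. The shuffle product $\sqcup\!\sqcup$ and quasi-shuffle product $\star$ are the bilinear products on $T(\mathfrak{A})$ with unit $e$ given, for words $u,v$ and $a,b\in\mathfrak{A}$, by $$ua\sqcup\!\sqcup vb=(u\sqcup\!\sqcup vb)a+(ua\sqcup\!\sqcup v)b,\qquad ua\star vb=(u\star vb)a+(ua\star v)b+(u\star v)[ab].$$ The half-shuffles are the bilinear operations on the span of nonempty words given by $$ua\succ vb=(ua\sqcup\!\sqcup v)b,\qquad ua\mathbin{\dot\succ}vb=(ua\star v)b.$$ Area operations. $\mathrm{area}(u,v)=u\succ v-v\succ u$ and (discrete area) $\mathtt{area}(u,v)=u\mathbin{\dot\succ}v-v\mathbin{\dot\succ}u$.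 Spaces. $D_1=\mathsf{D}_1$ is the vector space spanned by $\mathfrak{A}$ (words of length one), and inductively for $n\ge1$ $$D_{n+1}=\operatorname{span}_{\mathbb{F}}\{\mathrm{area}(D_{n+1-m},D_m):1\le m\le n\},\qquad \mathsf{D}_{n+1}=\operatorname{span}_{\mathbb{F}}\{\mathtt{area}(\mathsf{D}_{n+1-m},\mathsf{D}_m):1\le m\le n\},$$ and $D=\bigoplus_{n\ge1}D_n$, $\mathsf{D}=\bigoplus_{n\ge1}\mathsf{D}_n$, regarded as subspaces of $T(\mathfrak{A})$. Hoffman's exponential. For $n\ge1$, $\mathcal{C}(n)$ is the set of compositions of $n$, i.e. tuples $I=(i_1,\dots,i_p)$ of positive integers with sum $n$. For $I\in\mathcal{C}(n)$ and a word $w=w_1\cdots w_n$, set $I[w]=[w_1\cdots w_{i_1}][w_{i_1+1}\cdots w_{i_1+i_2}]\cdots[w_{i_1+\cdots+i_{p-1}+1}\cdots w_n]$, a word of length $p$. $\Phi_{\mathrm H}:T(\mathfrak{A})\to T(\mathfrak{A})$ is the linear map with $\Phi_{\mathrm H}(e)=e$ and $\Phi_{\mathrm H}(w)=\sum_{(i_1,\dots,i_p)\in\mathcal{C}(\ell(w))}\frac{1}{i_1!\cdots i_p!}I[w]$ for nonempty words. *)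

theory Defs
  imports Complex_Main "HOL-Library.Multiset" "HOL-Library.Poly_Mapping"
begin

section \<open>The extended alphabet\<close>

text \<open>The free commutative semigroup without unit on the letters \<open>'a\<close> is realised by the
  nonempty multisets of letters; the product \<open>[ab]\<close> is multiset union.\<close>

typedef 'a ext_letter = "{M :: 'a multiset. M \<noteq> {#}}"
  by (rule exI[of _ "{#undefined#}"]) simp

setup_lifting type_definition_ext_letter

instantiation ext_letter :: (type) ab_semigroup_mult
begin

lift_definition times_ext_letter :: "'a ext_letter \<Rightarrow> 'a ext_letter \<Rightarrow> 'a ext_letter"
  is "\<lambda>M N. M + N" by simp

instance by standard (transfer; simp add: ac_simps)+

end

text \<open>The iterated product \<open>[w\<^sub>1\<cdots>w\<^sub>p]\<close>. There is no empty product.\<close>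

fun bracket :: "'a ext_letter list \<Rightarrow> 'a ext_letter" where
  "bracket [] = undefined"
| "bracket [a] = a"
| "bracket (a # b # w) = a * bracket (b # w)"


section \<open>The free vector space on words\<close>

text \<open>\<open>'w \<Rightarrow>\<^sub>0 'f\<close> is the \<open>'f\<close>-vector space with basis \<open>'w\<close>; the space \<open>T(\<AA>)\<close> underlying
  the tensor algebra is the case where the basis consists of the words over \<open>'a ext_letter\<close>.\<close>

type_synonym ('a, 'f) tensor = "'a ext_letter list \<Rightarrow>\<^sub>0 'f"

definition scale :: "'f::field \<Rightarrow> ('w \<Rightarrow>\<^sub>0 'f) \<Rightarrow> ('w \<Rightarrow>\<^sub>0 'f)" where
  "scale c x = Poly_Mapping.map ((*) c) x"

lemma lookup_scale [simp]: "Poly_Mapping.lookup (scale c x) w = c * Poly_Mapping.lookup x w"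
  by (simp add: scale_def Poly_Mapping.map.rep_eq when_def)

global_interpretation tensor: vector_space scale
  by standard (auto intro!: poly_mapping_eqI simp: lookup_add algebra_simps)

abbreviation word :: "'w \<Rightarrow> ('w \<Rightarrow>\<^sub>0 'f::field)" where
  "word w \<equiv> Poly_Mapping.single w 1"

definition lin_ext :: "('v \<Rightarrow> ('w \<Rightarrow>\<^sub>0 'f)) \<Rightarrow> ('v \<Rightarrow>\<^sub>0 'f::field) \<Rightarrow> ('w \<Rightarrow>\<^sub>0 'f)" where
  "lin_ext f x = (\<Sum>v\<in>Poly_Mapping.keys x. scale (Poly_Mapping.lookup x v) (f v))"

definition bilin_ext ::
  "('u \<Rightarrow> 'v \<Rightarrow> ('w \<Rightarrow>\<^sub>0 'f)) \<Rightarrow> ('u \<Rightarrow>\<^sub>0 'f::field) \<Rightarrow> ('v \<Rightarrow>\<^sub>0 'f) \<Rightarrow> ('w \<Rightarrow>\<^sub>0 'f)" where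
  "bilin_ext f x y = lin_ext (\<lambda>u. lin_ext (\<lambda>v. f u v) y) x"

lemma lin_ext_word [simp]: "lin_ext f (word w) = f w"
  by (simp add: lin_ext_def)

lemma bilin_ext_word [simp]: "bilin_ext f (word u) (word v) = f u v"
  by (simp add: bilin_ext_def)

lemma lin_ext_superset:
  assumes "finite S" "Poly_Mapping.keys x \<subseteq> S"
  shows "lin_ext f x = (\<Sum>v\<in>S. scale (Poly_Mapping.lookup x v) (f v))"
  unfolding lin_ext_def using assms
  by (intro sum.mono_neutral_left) (auto simp: in_keys_iff)

lemma linear_lin_ext: "Vector_Spaces.linear scale scale (lin_ext f)"
proof -
  have add: "lin_ext f (x + y) = lin_ext f x + lin_ext f y" for x y
  proof -
    let ?S = "Poly_Mapping.keys x \<union> Poly_Mapping.keys y"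
    have "lin_ext f (x + y) = (\<Sum>v\<in>?S. scale (Poly_Mapping.lookup (x + y) v) (f v))"
      by (rule lin_ext_superset) (auto simp: Poly_Mapping.keys_add)
    also have "\<dots> = lin_ext f x + lin_ext f y"
      by (simp add: lin_ext_superset[of ?S x] lin_ext_superset[of ?S y] lookup_add
          tensor.scale_left_distrib sum.distrib)
    finally show ?thesis .
  qed
  have scal: "lin_ext f (scale c x) = scale c (lin_ext f x)" for c x
  proof -
    have "lin_ext f (scale c x) =
        (\<Sum>v\<in>Poly_Mapping.keys x. scale (Poly_Mapping.lookup (scale c x) v) (f v))"
      by (rule lin_ext_superset) (auto simp: in_keys_iff)
    then show ?thesis
      by (simp add: lin_ext_def tensor.scale_sum_right)
  qed
  show ?thesis
    by (intro Vector_Spaces.linear_iff[THEN iffD2] conjI allI)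
      (simp_all add: add scal tensor.vector_space_axioms)
qed


section \<open>Shuffles, half-shuffles and areas\<close>

definition snoc :: "('a, 'f::field) tensor \<Rightarrow> 'a ext_letter \<Rightarrow> ('a, 'f) tensor" where
  "snoc x a = lin_ext (\<lambda>w. word (w @ [a])) x"

function shuffle_word :: "'a ext_letter list \<Rightarrow> 'a ext_letter list \<Rightarrow> ('a, 'f::field) tensor" where
  "shuffle_word [] v = word v"
| "shuffle_word (u @ [a]) [] = word (u @ [a])"
| "shuffle_word (u @ [a]) (v @ [b]) =
    snoc (shuffle_word u (v @ [b])) a + snoc (shuffle_word (u @ [a]) v) b"
  by (auto, metis rev_exhaust)
termination by (relation "measure (\<lambda>(u, v). length u + length v)") auto

function quasi_shuffle_word ::
  "'a ext_letter list \<Rightarrow> 'a ext_letter list \<Rightarrow> ('a, 'f::field) tensor" where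
  "quasi_shuffle_word [] v = word v"
| "quasi_shuffle_word (u @ [a]) [] = word (u @ [a])"
| "quasi_shuffle_word (u @ [a]) (v @ [b]) =
    snoc (quasi_shuffle_word u (v @ [b])) a + snoc (quasi_shuffle_word (u @ [a]) v) b
      + snoc (quasi_shuffle_word u v) (a * b)"
  by (auto, metis rev_exhaust)
termination by (relation "measure (\<lambda>(u, v). length u + length v)") auto

text \<open>The half-shuffles are only meant to be used on the span of the nonempty words; they are
  made total by the value 0 as soon as one of the two words is empty.\<close>

function half_shuffle_word ::
  "'a ext_letter list \<Rightarrow> 'a ext_letter list \<Rightarrow> ('a, 'f::field) tensor" where
  "half_shuffle_word [] v = 0"
| "half_shuffle_word (u @ [a]) [] = 0"
| "half_shuffle_word (u @ [a]) (v @ [b]) = snoc (shuffle_word (u @ [a]) v) b"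
  by (auto, metis rev_exhaust)
termination by (relation "{}") auto

function quasi_half_shuffle_word ::
  "'a ext_letter list \<Rightarrow> 'a ext_letter list \<Rightarrow> ('a, 'f::field) tensor" where
  "quasi_half_shuffle_word [] v = 0"
| "quasi_half_shuffle_word (u @ [a]) [] = 0"
| "quasi_half_shuffle_word (u @ [a]) (v @ [b]) = snoc (quasi_shuffle_word (u @ [a]) v) b"
  by (auto, metis rev_exhaust)
termination by (relation "{}") auto

definition half_shuffle ::
  "('a, 'f::field) tensor \<Rightarrow> ('a, 'f) tensor \<Rightarrow> ('a, 'f) tensor" where
  "half_shuffle = bilin_ext half_shuffle_word"

definition quasi_half_shuffle ::
  "('a, 'f::field) tensor \<Rightarrow> ('a, 'f) tensor \<Rightarrow> ('a, 'f) tensor" where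
  "quasi_half_shuffle = bilin_ext quasi_half_shuffle_word"

definition area :: "('a, 'f::field) tensor \<Rightarrow> ('a, 'f) tensor \<Rightarrow> ('a, 'f) tensor" where
  "area x y = half_shuffle x y - half_shuffle y x"

definition discrete_area ::
  "('a, 'f::field) tensor \<Rightarrow> ('a, 'f) tensor \<Rightarrow> ('a, 'f) tensor" where
  "discrete_area x y = quasi_half_shuffle x y - quasi_half_shuffle y x"


section \<open>The spaces generated by the letters under an area operation\<close>

text \<open>The spaces are indexed from 1; index 0 carries the zero space.\<close>

fun area_level :: "(('a, 'f::field) tensor \<Rightarrow> ('a, 'f) tensor \<Rightarrow> ('a, 'f) tensor)
    \<Rightarrow> nat \<Rightarrow> ('a, 'f) tensor set" where
  "area_level ar 0 = {0}"
| "area_level ar (Suc 0) = tensor.span {word [a] | a. True}"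
| "area_level ar (Suc (Suc n)) = tensor.span
    (\<Union>m\<in>{1..Suc n}. {ar x y | x y.
       x \<in> area_level ar (Suc (Suc n) - m) \<and> y \<in> area_level ar m})"

text \<open>As a subspace of \<open>T(\<AA>)\<close>, the direct sum of the levels is the subspace they
  generate together, i.e. the set of finite sums of elements of the levels.\<close>

definition area_space :: "(('a, 'f::field) tensor \<Rightarrow> ('a, 'f) tensor \<Rightarrow> ('a, 'f) tensor)
    \<Rightarrow> ('a, 'f) tensor set" where
  "area_space ar = tensor.span (\<Union>n\<in>{1..}. area_level ar n)"

definition D_space :: "('a, 'f::field) tensor set" where
  "D_space = area_space area"

definition discrete_D_space :: "('a, 'f::field) tensor set" where
  "discrete_D_space = area_space discrete_area"


section \<open>Hoffman's exponential\<close>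

definition compositions :: "nat \<Rightarrow> nat list set" where
  "compositions n = {I. (\<forall>i\<in>set I. 0 < i) \<and> sum_list I = n}"

lemma finite_compositions [simp]: "finite (compositions n)"
proof (rule finite_subset)
  have len: "length I \<le> sum_list I" if "\<forall>i\<in>set I. 0 < i" for I :: "nat list"
    using that by (induction I) (auto simp: Suc_le_eq)
  show "compositions n \<subseteq> {I. set I \<subseteq> {..n} \<and> length I \<le> n}"
    using len by (auto simp: compositions_def intro: member_le_sum_list)
  show "finite {I :: nat list. set I \<subseteq> {..n} \<and> length I \<le> n}"
    by (rule finite_lists_length_le) simp
qed

text \<open>\<open>contract I w\<close> is \<open>I[w]\<close>, for \<open>I\<close> a composition of the length of \<open>w\<close>.\<close>

fun contract :: "nat list \<Rightarrow> 'a ext_letter list \<Rightarrow> 'a ext_letter list" where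
  "contract [] w = []"
| "contract (i # I) w = bracket (take i w) # contract I (drop i w)"

definition hoffman_exp_word :: "'a ext_letter list \<Rightarrow> ('a, 'f::field_char_0) tensor" where
  "hoffman_exp_word w =
    (if w = [] then word []
     else \<Sum>I\<in>compositions (length w). scale (1 / prod_list (map fact I)) (word (contract I w)))"

definition hoffman_exp :: "('a, 'f::field_char_0) tensor \<Rightarrow> ('a, 'f) tensor" where
  "hoffman_exp = lin_ext hoffman_exp_word"

lemma linear_hoffman_exp: "Vector_Spaces.linear scale scale hoffman_exp"
  unfolding hoffman_exp_def by (rule linear_lin_ext)

end

theory Submission
  imports Defs
begin

text \<open>Let \<open>E\<close> be the span of the letters and of all \<open>w(ab - ba)\<close>. Expanding last letters shows
  that \<open>E\<close> is closed under \<open>area\<close>, hence contains \<open>D\<close>. In \<open>\<Phi>\<^sub>H(wab) - \<Phi>\<^sub>H(wba)\<close> all terms whose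
  last block contains both \<open>a\<close> and \<open>b\<close> cancel, because blocks are commutative; so on \<open>E\<close> the map
  \<open>\<Phi>\<^sub>H\<close> coincides with \<open>\<Psi>(ua) = \<Phi>\<^sub>H(u)a\<close> (called \<open>hoffman_init\<close> below). Since \<open>\<Phi>\<^sub>H\<close> turns the
  shuffle into the quasi-shuffle product, \<open>\<Psi>\<close> of the half-shuffle of \<open>x\<close> and \<open>y\<close> is the quasi
  half-shuffle of \<open>\<Phi>\<^sub>H(x)\<close> and \<open>\<Psi>(y)\<close> for arbitrary \<open>x\<close> and \<open>y\<close>, and on \<open>E\<close> all occurrences
  of \<open>\<Psi>\<close> can be replaced by \<open>\<Phi>\<^sub>H\<close>.\<close>

section \<open>Linear and bilinear extension\<close>

interpretation lin_ext: Vector_Spaces.linear scale scale "lin_ext f"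
  for f :: "'v \<Rightarrow> 'w \<Rightarrow>\<^sub>0 'f::field"
  by (rule linear_lin_ext)

lemma lin_ext_zero_fun [simp]: "lin_ext (\<lambda>_. 0) x = 0"
  by (simp add: lin_ext_def)

lemma lin_ext_add_fun: "lin_ext (\<lambda>v. f v + g v) x = lin_ext f x + lin_ext g x"
  by (simp add: lin_ext_def tensor.scale_right_distrib sum.distrib)

lemma lin_ext_diff_fun: "lin_ext (\<lambda>v. f v - g v) x = lin_ext f x - lin_ext g x"
  by (simp add: lin_ext_def tensor.scale_right_diff_distrib sum_subtractf)

lemma lin_ext_scale_fun: "lin_ext (\<lambda>v. scale c (f v)) x = scale c (lin_ext f x)"
  by (simp add: lin_ext_def tensor.scale_sum_right mult.commute)

lemma lin_ext_lin_ext: "lin_ext f (lin_ext g x) = lin_ext (\<lambda>v. lin_ext f (g v)) x"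
  unfolding lin_ext_def[of g x] lin_ext_def[of "\<lambda>v. lin_ext f (g v)" x]
  by (simp add: lin_ext.sum lin_ext.scale)

lemma lin_ext_word_id [simp]: "lin_ext word x = x"
proof (rule poly_mapping_eqI)
  fix w
  show "Poly_Mapping.lookup (lin_ext word x) w = Poly_Mapping.lookup x w"
    by (simp add: lin_ext_def lookup_sum lookup_single when_def in_keys_iff
        if_distrib[of "(*) _"] cong: if_cong)
qed

text \<open>Interchange of two finite sums. \<open>bilin_ext\<close> is visibly linear only in its
  first argument; this form gives linearity in the second.\<close>

lemma bilin_ext_swap: "bilin_ext f x y = lin_ext (\<lambda>v. lin_ext (\<lambda>u. f u v) x) y"
  unfolding bilin_ext_def lin_ext_def tensor.scale_sum_right
  by (subst sum.swap) (simp add: mult.commute)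

lemma bilin_ext_lin_ext:
  "bilin_ext f (lin_ext g x) (lin_ext h y) = bilin_ext (\<lambda>u v. bilin_ext f (g u) (h v)) x y"
proof -
  have "bilin_ext f (lin_ext g x) (lin_ext h y) = lin_ext (\<lambda>u. bilin_ext f (g u) (lin_ext h y)) x"
    by (simp add: bilin_ext_def lin_ext_lin_ext)
  also have "\<dots> = lin_ext (\<lambda>u. lin_ext (\<lambda>v. bilin_ext f (g u) (h v)) y) x"
    by (simp add: bilin_ext_swap lin_ext_lin_ext)
  finally show ?thesis
    by (simp add: bilin_ext_def)
qed

lemma lin_ext_bilin_ext: "lin_ext g (bilin_ext f x y) = bilin_ext (\<lambda>u v. lin_ext g (f u v)) x y"
  by (simp add: bilin_ext_def lin_ext_lin_ext)

lemma bilin_ext_word_left: "bilin_ext f (word u) y = lin_ext (f u) y"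
  by (simp add: bilin_ext_def)

lemma bilin_ext_sum_left: "bilin_ext f (sum g I) y = (\<Sum>i\<in>I. bilin_ext f (g i) y)"
  by (simp add: bilin_ext_def lin_ext.sum)

lemma bilin_ext_sum_right: "bilin_ext f x (sum g I) = (\<Sum>i\<in>I. bilin_ext f x (g i))"
  by (simp add: bilin_ext_swap lin_ext.sum)

lemma bilin_ext_scale_left: "bilin_ext f (scale c x) y = scale c (bilin_ext f x y)"
  by (simp add: bilin_ext_def lin_ext.scale)

lemma bilin_ext_scale_right: "bilin_ext f x (scale c y) = scale c (bilin_ext f x y)"
  by (simp add: bilin_ext_swap lin_ext.scale)

lemma bilin_ext_add_left: "bilin_ext f (x + y) z = bilin_ext f x z + bilin_ext f y z"
  by (simp add: bilin_ext_def lin_ext.add)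

lemma bilin_ext_add_right: "bilin_ext f x (y + z) = bilin_ext f x y + bilin_ext f x z"
  by (simp add: bilin_ext_swap lin_ext.add)

lemma bilin_ext_diff_left: "bilin_ext f (x - y) z = bilin_ext f x z - bilin_ext f y z"
  by (simp add: bilin_ext_def lin_ext.diff)

lemma bilin_ext_diff_right: "bilin_ext f x (y - z) = bilin_ext f x y - bilin_ext f x z"
  by (simp add: bilin_ext_swap lin_ext.diff)

lemma bilin_ext_zero_right: "bilin_ext f x 0 = 0"
  by (simp add: bilin_ext_swap)

lemma bilin_ext_add_fun:
  "bilin_ext (\<lambda>u v. f u v + g u v) x y = bilin_ext f x y + bilin_ext g x y"
  by (simp add: bilin_ext_def lin_ext_add_fun)

section \<open>Appending a letter to a tensor\<close>

interpretation snoc: Vector_Spaces.linear scale scale "\<lambda>x. snoc x a" for a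
  unfolding snoc_def by (rule linear_lin_ext)

lemma snoc_word [simp]: "snoc (word w) a = word (w @ [a])"
  by (simp add: snoc_def)

lemma lin_ext_snoc: "lin_ext f (snoc x a) = lin_ext (\<lambda>w. f (w @ [a])) x"
  by (simp add: snoc_def lin_ext_lin_ext)

lemma snoc_lin_ext: "snoc (lin_ext f x) a = lin_ext (\<lambda>w. snoc (f w) a) x"
  by (simp add: snoc_def lin_ext_lin_ext)

lemma snoc_bilin_ext: "snoc (bilin_ext f x y) a = bilin_ext (\<lambda>u v. snoc (f u v) a) x y"
  by (simp add: snoc_def lin_ext_bilin_ext)

lemma bilin_ext_snoc_snoc:
  "bilin_ext f (snoc x a) (snoc y b) = bilin_ext (\<lambda>u v. f (u @ [a]) (v @ [b])) x y"
  by (simp add: snoc_def bilin_ext_lin_ext)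

lemma bilin_ext_snoc_left:
  "bilin_ext f (snoc x a) y = bilin_ext (\<lambda>u v. f (u @ [a]) v) x y"
  by (simp add: bilin_ext_def lin_ext_snoc)

lemma bilin_ext_snoc_right:
  "bilin_ext f x (snoc y b) = bilin_ext (\<lambda>u v. f u (v @ [b])) x y"
  by (simp add: bilin_ext_def lin_ext_snoc)


section \<open>Hoffman's exponential is multiplicative\<close>

lemma shuffle_word_Nil_right [simp]: "shuffle_word u [] = word u"
  by (cases u rule: rev_cases) auto

lemma quasi_shuffle_word_Nil_right [simp]: "quasi_shuffle_word u [] = word u"
  by (cases u rule: rev_cases) auto

lemma shuffle_word_commute: "shuffle_word u v = shuffle_word v u"
  by (induction u v rule: shuffle_word.induct) (auto simp: add.commute)

text \<open>By bilinearity the recursion on words extends to arbitrary tensors, which is needed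
  because \<open>hoffman_exp_word\<close> yields linear combinations of words.\<close>

lemma quasi_shuffle_snoc_snoc:
  "bilin_ext quasi_shuffle_word (snoc x a) (snoc y b) =
    snoc (bilin_ext quasi_shuffle_word x (snoc y b)) a
    + snoc (bilin_ext quasi_shuffle_word (snoc x a) y) b
    + snoc (bilin_ext quasi_shuffle_word x y) (a * b)"
  by (simp add: bilin_ext_snoc_snoc bilin_ext_snoc_left bilin_ext_snoc_right snoc_bilin_ext
      bilin_ext_add_fun)

text \<open>Summing over all ways to cut a suffix off a shuffle \<open>u \<sqcup>\<sqcup> v\<close> amounts to cutting suffixes
  off \<open>u\<close> and \<open>v\<close>; when the suffix matters only up to permutation, the shuffles of the two
  suffixes are merely counted, whence the binomial coefficient.\<close>

lemma suffix_sum_shuffle_word: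
  fixes g :: "'a ext_letter list \<Rightarrow> 'a ext_letter list \<Rightarrow> ('w \<Rightarrow>\<^sub>0 'f::field_char_0)"
  assumes "\<And>s t. mset s = mset t \<Longrightarrow> g s = g t"
  shows "lin_ext (\<lambda>w. \<Sum>i\<le>length w. g (drop i w) (take i w)) (shuffle_word u v) =
    (\<Sum>i\<le>length u. \<Sum>j\<le>length v.
      scale (of_nat ((length u - i + (length v - j)) choose (length u - i)))
        (lin_ext (g (drop i u @ drop j v)) (shuffle_word (take i u) (take j v))))"
  using assms
proof (induction u v arbitrary: g rule: shuffle_word.induct)
  case (1 v)
  show ?case by simp
next
  case (2 u a)
  show ?case by simp
next
  case (3 u a v b)
  define f where "f g w = (\<Sum>i\<le>length w. g (drop i w) (take i w))"
    for g :: "'a ext_letter list \<Rightarrow> 'a ext_letter list \<Rightarrow> ('w \<Rightarrow>\<^sub>0 'f)" and w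
  define t where "t i j = lin_ext (g (drop i (u @ [a]) @ drop j (v @ [b])))
    (shuffle_word (take i (u @ [a])) (take j (v @ [b])))" for i j
  have f_eq: "f g = (\<lambda>w. \<Sum>i\<le>length w. g (drop i w) (take i w))" for g
    by (simp add: f_def fun_eq_iff)
  define C :: "nat \<Rightarrow> nat \<Rightarrow> 'f" where "C p q = of_nat ((p + q) choose p)" for p q
  have C_0: "C p 0 = 1" "C 0 q = 1" for p q
    by (simp_all add: C_def)
  \<comment> \<open>The empty suffix is split off; every other suffix of \<open>w @ [c]\<close> ends
    with \<open>c\<close>. The modified \<open>g\<close> on the right is why the induction keeps
    \<open>g\<close> arbitrary.\<close>
  have f_snoc: "f g (w @ [c]) = g [] (w @ [c]) + f (\<lambda>s. g (s @ [c])) w" for w c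
    by (simp add: f_def)
  have step: "lin_ext (f g) (snoc x c) = lin_ext (g []) (snoc x c) + lin_ext (f (\<lambda>s. g (s @ [c]))) x"
    for x c
    by (simp add: lin_ext_snoc f_snoc lin_ext_add_fun)
  \<comment> \<open>Here \<open>a\<close> ends the shuffle and lies in the suffix, so
    \<open>i\<close> stops at \<open>length u\<close>. Moving \<open>a\<close> back behind
    \<open>drop i u\<close> only permutes the suffix.\<close>
  have ga: "lin_ext (f (\<lambda>s. g (s @ [a]))) (shuffle_word u (v @ [b])) =
    (\<Sum>i\<le>length u. \<Sum>j\<le>Suc (length v).
      scale (C (length u - i) (Suc (length v) - j)) (t i j))"
  proof -
    have "lin_ext (f (\<lambda>s. g (s @ [a]))) (shuffle_word u (v @ [b])) =
      (\<Sum>i\<le>length u. \<Sum>j\<le>length (v @ [b]).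
      scale (of_nat ((length u - i + (length (v @ [b]) - j)) choose (length u - i)))
        (lin_ext (g ((drop i u @ drop j (v @ [b])) @ [a]))
          (shuffle_word (take i u) (take j (v @ [b])))))"
      unfolding f_eq by (rule "3.IH"(1)) (rule "3.prems", simp)
    also have "\<dots> = (\<Sum>i\<le>length u. \<Sum>j\<le>Suc (length v).
      scale (C (length u - i) (Suc (length v) - j)) (t i j))"
      unfolding t_def C_def
      by (intro sum.cong refl)
        (auto intro!: arg_cong2[where f=lin_ext] arg_cong2[where f=scale] "3.prems")
    finally show ?thesis .
  qed
  have gb: "lin_ext (f (\<lambda>s. g (s @ [b]))) (shuffle_word (u @ [a]) v) =
    (\<Sum>i\<le>Suc (length u). \<Sum>j\<le>length v.
      scale (C (Suc (length u) - i) (length v - j)) (t i j))"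
  proof -
    have "lin_ext (f (\<lambda>s. g (s @ [b]))) (shuffle_word (u @ [a]) v) =
      (\<Sum>i\<le>length (u @ [a]). \<Sum>j\<le>length v.
      scale (of_nat ((length (u @ [a]) - i + (length v - j)) choose (length (u @ [a]) - i)))
        (lin_ext (g ((drop i (u @ [a]) @ drop j v) @ [b]))
          (shuffle_word (take i (u @ [a])) (take j v))))"
      unfolding f_eq by (rule "3.IH"(2)) (rule "3.prems", simp)
    also have "\<dots> = (\<Sum>i\<le>Suc (length u). \<Sum>j\<le>length v.
      scale (C (Suc (length u) - i) (length v - j)) (t i j))"
      unfolding t_def C_def
      by (intro sum.cong refl)
        (auto intro!: arg_cong2[where f=lin_ext] arg_cong2[where f=scale] "3.prems")
    finally show ?thesis .
  qed
  \<comment> \<open>Pascal's rule: a nonempty shuffle of the two suffixes ends with \<open>a\<close>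
    or with \<open>b\<close>.\<close>
  have pascal: "C (Suc (length u) - i) (Suc (length v) - j) =
      C (length u - i) (Suc (length v) - j) + C (Suc (length u) - i) (length v - j)"
    if "i \<le> length u" "j \<le> length v" for i j
    using that by (simp add: C_def Suc_diff_le)
  have "lin_ext (f g) (shuffle_word (u @ [a]) (v @ [b])) =
    t (Suc (length u)) (Suc (length v)) + lin_ext (f (\<lambda>s. g (s @ [a]))) (shuffle_word u (v @ [b]))
    + lin_ext (f (\<lambda>s. g (s @ [b]))) (shuffle_word (u @ [a]) v)"
    by (simp add: lin_ext.add step t_def algebra_simps)
  \<comment> \<open>Interior terms add up by Pascal's rule. On each border one suffix is empty, only
    one of the two sums contributes, and all coefficients are 1; the corner is the empty
    suffix.\<close>
  also have "\<dots> = (\<Sum>i\<le>Suc (length u). \<Sum>j\<le>Suc (length v).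
      scale (C (Suc (length u) - i) (Suc (length v) - j)) (t i j))"
    unfolding ga gb 
    by (simp add: pascal C_0 sum.distrib tensor.scale_left_distrib add_ac)
  finally show ?case
    by (simp add: t_def f_eq C_def)
qed

section \<open>Blocks, compositions and the recursion on the last block\<close>

lemma Rep_bracket: "w \<noteq> [] \<Longrightarrow> Rep_ext_letter (bracket w) = sum_list (map Rep_ext_letter w)"
  by (induction w rule: bracket.induct) (simp_all add: times_ext_letter.rep_eq)

text \<open>Commutativity of blocks: a block is represented by the sum of its letters as multisets,
  which forgets their order.\<close>

lemma bracket_cong_mset:
  assumes "mset s = mset t"
  shows "bracket s = bracket t"
proof (cases "s = []")
  case False
  then have "t \<noteq> []" using assms by auto
  have "sum_mset (image_mset Rep_ext_letter (mset s)) = sum_mset (image_mset Rep_ext_letter (mset t))"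
    by (simp add: assms)
  then have "sum_list (map Rep_ext_letter s) = sum_list (map Rep_ext_letter t)"
    by (metis mset_map sum_mset_sum_list)
  then show ?thesis
    using False \<open>t \<noteq> []\<close> by (metis Rep_bracket Rep_ext_letter_inject)
qed (use assms in auto)

lemma bracket_append: "s \<noteq> [] \<Longrightarrow> t \<noteq> [] \<Longrightarrow> bracket (s @ t) = bracket s * bracket t"
  by (metis Rep_bracket Rep_ext_letter_inject append_is_Nil_conv map_append sum_list_append
      times_ext_letter.rep_eq)

lemma compositions_0: "compositions 0 = {[]}"
  by (auto simp: compositions_def) (metis list.set_intros(1) neq_Nil_conv less_irrefl)

text \<open>Compositions are sorted by the sum \<open>i\<close> of all parts but the last;
  \<open>n > 0\<close> ensures that a last part exists.\<close>

lemma compositions_last: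
  assumes "n > 0"
  shows "compositions n = (\<Union>i<n. (\<lambda>I. I @ [n - i]) ` compositions i)"
proof (intro equalityI subsetI)
  fix I assume I: "I \<in> compositions n"
  then have "I \<noteq> []" using assms by (auto simp: compositions_def)
  then obtain J j where J: "I = J @ [j]" by (metis rev_exhaust)
  with I have "J \<in> compositions (sum_list J)" "sum_list J < n" "j = n - sum_list J"
    by (auto simp: compositions_def)
  then show "I \<in> (\<Union>i<n. (\<lambda>I. I @ [n - i]) ` compositions i)"
    using J by blast
qed (auto simp: compositions_def)

lemma contract_append_last:
  "sum_list I = i \<Longrightarrow> contract (I @ [length w - i]) w = contract I (take i w) @ [bracket (drop i w)]"
proof (induction I arbitrary: i w)
  case (Cons k I)
  then show ?case
    using Cons.IH[of "sum_list I" "drop k w"]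
    by (auto simp: drop_take add.commute[of "sum_list I" k])
qed simp

text \<open>The sum also covers the empty word, whose only composition is empty, so the prefix of
  length 0 needs no special treatment below.\<close>

lemma hoffman_exp_word_altdef:
  "hoffman_exp_word w =
    (\<Sum>I\<in>compositions (length w). scale (1 / prod_list (map fact I)) (word (contract I w)))"
  by (simp add: hoffman_exp_word_def compositions_0)

lemma hoffman_exp_word_Nil [simp]: "hoffman_exp_word [] = word []"
  by (simp add: hoffman_exp_word_def)

text \<open>The summand for \<open>i\<close> collects the compositions with last part \<open>length w - i\<close>.\<close>

lemma hoffman_exp_word_last:
  assumes "w \<noteq> []"
  shows "hoffman_exp_word w = (\<Sum>i<length w.
    scale (1 / fact (length w - i)) (snoc (hoffman_exp_word (take i w)) (bracket (drop i w))))"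
proof -
  let ?n = "length w"
  let ?c = "\<lambda>I. scale (1 / prod_list (map fact I)) (word (contract I w)) :: ('a, 'b) tensor"
  have disj: "(\<lambda>I. I @ [?n - i]) ` compositions i \<inter> (\<lambda>I. I @ [?n - j]) ` compositions j = {}"
    if "i \<noteq> j" for i j
    using that by (auto simp: compositions_def)
  have "hoffman_exp_word w = sum ?c (\<Union>i<?n. (\<lambda>I. I @ [?n - i]) ` compositions i)"
    using assms by (simp add: hoffman_exp_word_altdef flip: compositions_last)
  also have "\<dots> = (\<Sum>i<?n. sum ?c ((\<lambda>I. I @ [?n - i]) ` compositions i))"
    using disj by (intro sum.UNION_disjoint) auto
  also have "\<dots> = (\<Sum>i<?n. \<Sum>I\<in>compositions i. ?c (I @ [?n - i]))"
    by (simp add: sum.reindex inj_on_def)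
  also have "\<dots> = (\<Sum>i<?n. scale (1 / fact (?n - i))
      (snoc (hoffman_exp_word (take i w)) (bracket (drop i w))))"
  proof (intro sum.cong refl)
    fix i assume "i \<in> {..<?n}"
    have "?c (I @ [?n - i]) = scale (1 / fact (?n - i)) (snoc (scale (1 / prod_list (map fact I))
        (word (contract I (take i w)))) (bracket (drop i w)))" if "I \<in> compositions i" for I
      using that by (simp add: compositions_def contract_append_last snoc.scale mult.commute)
    then show "(\<Sum>I\<in>compositions i. ?c (I @ [?n - i])) = scale (1 / fact (?n - i))
        (snoc (hoffman_exp_word (take i w)) (bracket (drop i w)))"
      using \<open>i \<in> {..<?n}\<close>
      by (simp add: hoffman_exp_word_altdef snoc.sum tensor.scale_sum_right)
  qed
  finally show ?thesis .
qed

text \<open>The last block of a contracted shuffle takes letters from \<open>u\<close> only, from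
  \<open>v\<close> only, or from both. These cases match the three terms of the quasi-shuffle
  recursion, and induction on the total length handles the prefixes.\<close>

lemma hoffman_exp_shuffle_word:
  "hoffman_exp (shuffle_word u v) =
    bilin_ext quasi_shuffle_word (hoffman_exp_word u) (hoffman_exp_word v)"
proof (induction "length u + length v" arbitrary: u v rule: less_induct)
  case less
  let ?q = "bilin_ext quasi_shuffle_word"
  let ?m = "length u" and ?n = "length v"
  show ?case
  proof (cases "u = [] \<or> v = []")
    case True
    then show ?thesis
      by (auto simp: hoffman_exp_def bilin_ext_word_left bilin_ext_swap)
  next
    case False
    \<comment> \<open>The value 0 on the empty suffix reconciles the sum over
      \<open>i \<le> length w\<close> in \<open>suffix_sum_shuffle_word\<close> with the sum over
      \<open>i < length w\<close> in \<open>hoffman_exp_word_last\<close>.\<close>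
    define g :: "'a ext_letter list \<Rightarrow> 'a ext_letter list \<Rightarrow> ('a, 'b) tensor" where
      "g s w = (if s = [] then 0
        else scale (1 / fact (length s)) (snoc (hoffman_exp_word w) (bracket s)))"
      for s w
    have g_Nil: "g [] = (\<lambda>_. 0)"
      by (simp add: g_def fun_eq_iff)
    have g_cong: "g s = g t" if "mset s = mset t" for s t
      using that by (auto simp: g_def fun_eq_iff bracket_cong_mset[OF that] dest: mset_eq_length)
    have hoffman_g: "hoffman_exp_word w = (\<Sum>i\<le>length w. g (drop i w) (take i w))" if "w \<noteq> []" for w
    proof -
      have "{..length w} = insert (length w) {..<length w}" by auto
      then show ?thesis
        using that by (simp add: hoffman_exp_word_last g_def)
    qed
    have g_lin: "lin_ext (g s) x = scale (1 / fact (length s)) (snoc (hoffman_exp x) (bracket s))"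
      if "s \<noteq> []" for s x
    proof -
      have "g s = (\<lambda>w. scale (1 / fact (length s)) (snoc (hoffman_exp_word w) (bracket s)))"
        using that by (simp add: g_def fun_eq_iff)
      then show ?thesis
        by (simp add: lin_ext_scale_fun hoffman_exp_def snoc_lin_ext)
    qed
    define h where "h i w = (1 / fact (length w - i) :: 'b)" for i and w :: "'a ext_letter list"
    define H :: "'a ext_letter list \<Rightarrow> nat \<Rightarrow> ('a, 'b) tensor" where
      "H w i = hoffman_exp_word (take i w)" for w i
    define l where "l i w = bracket (drop i w)" for i and w :: "'a ext_letter list"
    have H_sum: "hoffman_exp_word w = (\<Sum>i<length w. scale (h i w) (snoc (H w i) (l i w)))"
      if "w \<noteq> []" for w
      using hoffman_exp_word_last[OF that] by (simp add: h_def H_def l_def)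
    let ?t = "\<lambda>i j. scale (of_nat ((?m - i + (?n - j)) choose (?m - i)))
        (lin_ext (g (drop i u @ drop j v)) (shuffle_word (take i u) (take j v)))"
    have "hoffman_exp (shuffle_word u v) =
        lin_ext (\<lambda>w. \<Sum>i\<le>length w. g (drop i w) (take i w)) (shuffle_word u v)"
    \<comment> \<open>Both words are nonempty, so the shuffle is a sum of words with a last letter,
      to which \<open>hoffman_g\<close> applies.\<close>
    proof -
      obtain u' a v' b where "u = u' @ [a]" "v = v' @ [b]"
        using False by (metis rev_exhaust)
      then show ?thesis
        by (simp add: hoffman_exp_def lin_ext.add lin_ext_snoc hoffman_g del: sum.atMost_Suc)
    qed
    also have "\<dots> = (\<Sum>i\<le>?m. \<Sum>j\<le>?n. ?t i j)"
      by (rule suffix_sum_shuffle_word) (rule g_cong)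
    \<comment> \<open>The corner \<open>i = ?m\<close>, \<open>j = ?n\<close> has an empty suffix
      and vanishes.\<close>
    also have "\<dots> = (\<Sum>i<?m. \<Sum>j<?n. ?t i j) + (\<Sum>i<?m. ?t i ?n) + (\<Sum>j<?n. ?t ?m j)"
      by (simp add: g_Nil sum.distrib flip: lessThan_Suc_atMost)
    also have "(\<Sum>i<?m. ?t i ?n) = (\<Sum>i<?m. scale (h i u)
        (snoc (?q (H u i) (hoffman_exp_word v)) (l i u)))"
      using less by (intro sum.cong refl) (simp add: g_lin H_def l_def h_def)
    also have "(\<Sum>j<?n. ?t ?m j) = (\<Sum>j<?n. scale (h j v)
        (snoc (?q (hoffman_exp_word u) (H v j)) (l j v)))"
      using less by (intro sum.cong refl) (simp add: g_lin H_def l_def h_def)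
    \<comment> \<open>With \<open>p\<close> and \<open>q\<close> letters from the two words, the
      binomial coefficient divided by \<open>(p + q)!\<close> is \<open>1 / (p! q!)\<close>.\<close>
    also have "(\<Sum>i<?m. \<Sum>j<?n. ?t i j) = (\<Sum>i<?m. \<Sum>j<?n. scale (h i u * h j v)
        (snoc (?q (H u i) (H v j)) (l i u * l j v)))"
      using less by (intro sum.cong refl)
        (simp add: g_lin H_def l_def h_def bracket_append binomial_fact)
    also have "\<dots> + (\<Sum>i<?m. scale (h i u) (snoc (?q (H u i) (hoffman_exp_word v)) (l i u)))
        + (\<Sum>j<?n. scale (h j v) (snoc (?q (hoffman_exp_word u) (H v j)) (l j v)))
      = (\<Sum>i<?m. \<Sum>j<?n. scale (h i u * h j v) (?q (snoc (H u i) (l i u)) (snoc (H v j) (l j v))))"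
    proof -
      \<comment> \<open>Splitting off the last block of the untouched factor turns the single sums
        into double sums, so that the recursion applies termwise.\<close>
      have 1: "(\<Sum>i<?m. scale (h i u) (snoc (?q (H u i) (hoffman_exp_word v)) (l i u))) =
        (\<Sum>i<?m. \<Sum>j<?n. scale (h i u * h j v) (snoc (?q (H u i) (snoc (H v j) (l j v))) (l i u)))"
        using False by (simp add: H_sum[of v] bilin_ext_sum_right bilin_ext_scale_right snoc.sum
            snoc.scale tensor.scale_sum_right)
      have "(\<Sum>j<?n. scale (h j v) (snoc (?q (hoffman_exp_word u) (H v j)) (l j v))) =
        (\<Sum>j<?n. \<Sum>i<?m. scale (h i u * h j v) (snoc (?q (snoc (H u i) (l i u)) (H v j)) (l j v)))"
        using False by (simp add: H_sum[of u] bilin_ext_sum_left bilin_ext_scale_left snoc.sum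
            snoc.scale tensor.scale_sum_right mult.commute)
      also have "\<dots> =
        (\<Sum>i<?m. \<Sum>j<?n. scale (h i u * h j v) (snoc (?q (snoc (H u i) (l i u)) (H v j)) (l j v)))"
        by (rule sum.swap)
      finally show ?thesis
        unfolding 1
        by (simp add: quasi_shuffle_snoc_snoc tensor.scale_right_distrib sum.distrib algebra_simps)
    qed
    also have "\<dots> = (\<Sum>i<?m. scale (h i u) (?q (snoc (H u i) (l i u)) (hoffman_exp_word v)))"
      using False by (simp add: H_sum[of v] bilin_ext_sum_right bilin_ext_scale_right
          tensor.scale_sum_right)
    also have "\<dots> = ?q (hoffman_exp_word u) (hoffman_exp_word v)"
      using False by (simp add: H_sum[of u] bilin_ext_sum_left bilin_ext_scale_left)
    finally show ?thesis .
  qed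
qed


section \<open>The span of the letters and of the words with antisymmetrised last two letters\<close>

text \<open>The space \<open>E\<close> of the introduction. Its explicit generators allow linear
  identities to be checked on words, unlike the inductively defined \<open>D_space\<close>.\<close>

definition antisym_space :: "('a, 'f::field) tensor set" where
  "antisym_space = tensor.span
    (range (\<lambda>a. word [a]) \<union> {word (w @ [a, b]) - word (w @ [b, a]) | w a b. True})"

lemma subspace_antisym_space: "tensor.subspace antisym_space"
  unfolding antisym_space_def by (rule tensor.subspace_span)

lemmas antisym_space_closed =
  tensor.subspace_0[OF subspace_antisym_space]
  tensor.subspace_add[OF subspace_antisym_space]
  tensor.subspace_diff[OF subspace_antisym_space]
  tensor.subspace_scale[OF subspace_antisym_space]
  tensor.subspace_sum[OF subspace_antisym_space]

lemma word_letter_in_antisym_space: "word [a] \<in> antisym_space"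
  unfolding antisym_space_def by (rule tensor.span_base) auto

lemma snoc_snoc_diff_in_antisym_space:
  "snoc (snoc x a) b - snoc (snoc x b) a \<in> antisym_space"
proof -
  have "word (w @ [a, b]) - word (w @ [b, a]) \<in> antisym_space" for w
    unfolding antisym_space_def by (rule tensor.span_base) auto
  then have "lin_ext (\<lambda>w. word (w @ [a, b]) - word (w @ [b, a])) x \<in> antisym_space"
    unfolding lin_ext_def
    by (intro tensor.subspace_sum tensor.subspace_scale subspace_antisym_space)
  also have "lin_ext (\<lambda>w. word (w @ [a, b]) - word (w @ [b, a])) x =
      snoc (snoc x a) b - snoc (snoc x b) a"
    by (simp add: snoc_def lin_ext_lin_ext lin_ext_diff_fun)
  finally show ?thesis .
qed

section \<open>Closure under the area operation\<close>

lemma area_words: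
  "area (word (u @ [a])) (word (v @ [b])) =
    snoc (shuffle_word (u @ [a]) v) b - snoc (shuffle_word (v @ [b]) u) a"
  by (simp add: area_def half_shuffle_def)

lemma area_swap: "area x y = - area y x"
  by (simp add: area_def)

lemma area_diff_left: "area (x - y) z = area x z - area y z"
  by (simp add: area_def half_shuffle_def bilin_ext_diff_left bilin_ext_diff_right)

lemma area_diff_right: "area x (y - z) = area x y - area x z"
  by (simp add: area_def half_shuffle_def bilin_ext_diff_left bilin_ext_diff_right)

lemma linear_area_left: "Vector_Spaces.linear scale scale (\<lambda>x. area x y)"
  by (intro Vector_Spaces.linear_iff[THEN iffD2] conjI allI)
    (simp_all add: tensor.vector_space_axioms area_def half_shuffle_def bilin_ext_add_left
      bilin_ext_add_right bilin_ext_scale_left bilin_ext_scale_right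
      tensor.scale_right_diff_distrib)

lemma linear_area_right: "Vector_Spaces.linear scale scale (area x)"
  by (intro Vector_Spaces.linear_iff[THEN iffD2] conjI allI)
    (simp_all add: tensor.vector_space_axioms area_def half_shuffle_def bilin_ext_add_left
      bilin_ext_add_right bilin_ext_scale_left bilin_ext_scale_right
      tensor.scale_right_diff_distrib)

lemma area_antisym_letter:
  "area (word (w @ [a, b]) - word (w @ [b, a])) (word [c]) \<in> antisym_space"
proof -
  let ?x = "word w" and ?y = "shuffle_word w [c]"
  have 1: "shuffle_word [c] (w @ [p]) = snoc (snoc ?x p) c + snoc ?y p" for p
    using shuffle_word.simps(3)[of "[]" c w p] by (simp add: shuffle_word_commute[of w])
  have 2: "area (word (w @ [p, q])) (word [c]) =
      snoc (snoc (snoc ?x p) q) c - snoc (snoc (snoc ?x p) c) q - snoc (snoc ?y p) q" for p q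
    using area_words[of "w @ [p]" q "[]" c] by (simp add: 1 snoc.add algebra_simps)
  \<comment> \<open>Terms are paired with those whose last two letters are exchanged; the
    \<open>?y\<close> terms find their partners only through the antisymmetry in \<open>a\<close>
    and \<open>b\<close>.\<close>
  have "area (word (w @ [a, b]) - word (w @ [b, a])) (word [c]) =
     (snoc (snoc (snoc ?x a) b) c - snoc (snoc (snoc ?x a) c) b)
     - (snoc (snoc (snoc ?x b) a) c - snoc (snoc (snoc ?x b) c) a)
     - (snoc (snoc ?y a) b - snoc (snoc ?y b) a)"
    unfolding area_diff_left 2 by simp
  also have "\<dots> \<in> antisym_space"
    by (intro antisym_space_closed snoc_snoc_diff_in_antisym_space)
  finally show ?thesis .
qed

lemma area_antisym_antisym:
  "area (word (w @ [a, b]) - word (w @ [b, a])) (word (v @ [c, d]) - word (v @ [d, c]))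
    \<in> antisym_space"
proof -
  let ?z = "\<lambda>p r. shuffle_word (w @ [p]) (v @ [r])"
  let ?X = "\<lambda>p q. shuffle_word (w @ [p, q]) v" and ?Y = "\<lambda>r s. shuffle_word (v @ [r, s]) w"
  have 1: "shuffle_word (w @ [p, q]) (v @ [r]) = snoc (?z p r) q + snoc (?X p q) r" for p q r
    using shuffle_word.simps(3)[of "w @ [p]" q v r] by simp
  have 2: "shuffle_word (v @ [r, s]) (w @ [p]) = snoc (?z p r) s + snoc (?Y r s) p" for p r s
    using shuffle_word.simps(3)[of "v @ [r]" s w p]
    by (simp add: shuffle_word_commute[of "v @ [r]" "w @ [p]"] del: shuffle_word.simps)
  \<comment> \<open>The \<open>?z\<close> part is already a difference of the required kind. The
    \<open>?X\<close> part becomes one after antisymmetrising in \<open>r\<close> and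
    \<open>s\<close>, the \<open>?Y\<close> part after doing so in \<open>p\<close> and
    \<open>q\<close>.\<close>
  have 3: "area (word (w @ [p, q])) (word (v @ [r, s])) =
      (snoc (snoc (?z p r) q) s - snoc (snoc (?z p r) s) q)
      + snoc (snoc (?X p q) r) s - snoc (snoc (?Y r s) p) q" for p q r s
    using area_words[of "w @ [p]" q "v @ [r]" s]
    by (simp add: 1 2 snoc.add algebra_simps del: shuffle_word.simps)
  let ?A = "\<lambda>x p q. snoc (snoc x p) q - snoc (snoc x q) p"
  have "area (word (w @ [a, b]) - word (w @ [b, a])) (word (v @ [c, d]) - word (v @ [d, c])) =
     ?A (?z a c) b d - ?A (?z a d) b c - ?A (?z b c) a d + ?A (?z b d) a c
     + ?A (?X a b) c d - ?A (?X b a) c d - ?A (?Y c d) a b + ?A (?Y d c) a b"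
    unfolding area_diff_left area_diff_right 3 by (simp add: algebra_simps)
  also have "\<dots> \<in> antisym_space"
    by (intro antisym_space_closed snoc_snoc_diff_in_antisym_space)
  finally show ?thesis .
qed

lemma area_in_antisym_space:
  assumes "x \<in> antisym_space" "y \<in> antisym_space"
  shows "area x y \<in> antisym_space"
proof -
  let ?G = "range (\<lambda>a. word [a]) \<union> {word (w @ [a, b]) - word (w @ [b, a]) | w a b. True}
    :: ('a, 'b) tensor set"
  have letters: "area (word [a]) (word [b]) \<in> (antisym_space :: ('a, 'b) tensor set)" for a b :: "'a ext_letter"
    using snoc_snoc_diff_in_antisym_space[of "word [] :: ('a, 'b) tensor" a b]
    by (simp add: area_words[of "[]" a "[]" b, simplified])
  \<comment> \<open>A letter in the first argument against a difference in the second is reduced to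
    \<open>area_antisym_letter\<close> by antisymmetry of \<open>area\<close>.\<close>
  have gen: "area g h \<in> antisym_space" if "g \<in> ?G" "h \<in> ?G" for g h
    using that letters area_antisym_letter area_antisym_antisym
      tensor.subspace_neg[OF subspace_antisym_space area_antisym_letter]
    by (auto simp flip: area_swap)
  have left: "area x h \<in> antisym_space" if "h \<in> ?G" for h
  proof -
    interpret Vector_Spaces.linear scale scale "\<lambda>x. area x h" by (rule linear_area_left)
    show ?thesis
      using assms(1)[unfolded antisym_space_def]
      by (induction rule: tensor.span_induct_alt)
        (auto simp: add scale intro!: antisym_space_closed gen[OF _ that])
  qed
  interpret Vector_Spaces.linear scale scale "area x" by (rule linear_area_right)
  show ?thesis
    using assms(2)[unfolded antisym_space_def]
    by (induction rule: tensor.span_induct_alt)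
      (auto simp: add scale intro!: antisym_space_closed left)
qed

lemma nat_cases_2: "\<lbrakk>n = 0 \<Longrightarrow> P; n = Suc 0 \<Longrightarrow> P; \<And>k. n = Suc (Suc k) \<Longrightarrow> P\<rbrakk> \<Longrightarrow> P"
  by (metis not0_implies_Suc)

lemma area_level_subset_antisym_space: "area_level area n \<subseteq> (antisym_space :: ('a, 'f::field) tensor set)"
proof (induction n rule: less_induct)
  case (less n)
  show ?case
  proof (cases n rule: nat_cases_2)
    case 1
    then show ?thesis by (simp add: antisym_space_closed)
  next
    case 2
    show ?thesis
      unfolding 2 area_level.simps
      by (intro tensor.span_minimal subspace_antisym_space) (auto intro: word_letter_in_antisym_space)
  next
    case (3 k)
    have "area x y \<in> antisym_space" if "m \<in> {1..Suc k}" "x \<in> area_level area (Suc (Suc k) - m)"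
      "y \<in> area_level area m"
      for m and x y :: "('a, 'f) tensor"
      \<comment> \<open>Both indices are below \<open>n\<close>, since \<open>m\<close> lies between
        1 and \<open>Suc k\<close>.\<close>
      using that 3 less[of "Suc (Suc k) - m"] less[of m] by (intro area_in_antisym_space) auto
    then show ?thesis
      unfolding 3 area_level.simps by (intro tensor.span_minimal subspace_antisym_space) auto
  qed
qed

lemma D_space_subset_antisym_space: "D_space \<subseteq> antisym_space"
  unfolding D_space_def area_space_def using area_level_subset_antisym_space
  by (intro tensor.span_minimal subspace_antisym_space) blast


section \<open>Hoffman's exponential and areas\<close>

text \<open>Only compositions with last part 1 are kept. The value 0 at the empty word fits the
  half-shuffles, which vanish there.\<close>

definition hoffman_init :: "('a, 'f::field_char_0) tensor \<Rightarrow> ('a, 'f) tensor" where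
  "hoffman_init =
    lin_ext (\<lambda>w. if w = [] then 0 else snoc (hoffman_exp_word (butlast w)) (last w))"

lemma hoffman_init_snoc: "hoffman_init (snoc x a) = snoc (hoffman_exp x) a"
  by (simp add: hoffman_init_def hoffman_exp_def lin_ext_snoc snoc_lin_ext)

lemma hoffman_exp_letter: "hoffman_exp (word [a]) = word [a]"
  using hoffman_exp_word_last[of "[a]"] by (simp add: hoffman_exp_def)

text \<open>The contractions absorbing the last two letters cancel.\<close>

lemma hoffman_exp_antisym:
  "hoffman_exp (word (w @ [a, b]) - word (w @ [b, a])) =
    hoffman_init (word (w @ [a, b]) - word (w @ [b, a]))"
proof -
  \<comment> \<open>The range \<open>i \<le> length w\<close> collects the last blocks containing
    both \<open>p\<close> and \<open>q\<close>; the one remaining index leaves \<open>q\<close>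
    alone and gives the value of \<open>hoffman_init\<close>.\<close>
  let ?r = "\<lambda>p q. \<Sum>i<Suc (length w). scale (1 / fact (length w + 2 - i))
      (snoc (hoffman_exp_word (take i w)) (bracket (drop i w @ [p, q]))) :: ('a, 'b) tensor"
  have last: "hoffman_exp_word (w @ [p, q]) = ?r p q + snoc (hoffman_exp_word (w @ [p])) q" for p q
    by (subst hoffman_exp_word_last) simp_all
  have "?r a b = ?r b a"
    by (intro sum.cong refl arg_cong2[where f=scale] arg_cong2[where f=snoc] bracket_cong_mset) simp
  moreover have "hoffman_init (word (w @ [p, q])) = snoc (hoffman_exp_word (w @ [p])) q" for p q
    by (simp add: hoffman_init_def butlast_append)
  ultimately show ?thesis
    by (simp add: hoffman_exp_def hoffman_init_def lin_ext.diff last butlast_append)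
qed

text \<open>Two linear maps that agree on the generators: both fix letters, and the differences are
  treated in \<open>hoffman_exp_antisym\<close>.\<close>

lemma hoffman_exp_eq_init:
  assumes "x \<in> antisym_space"
  shows "hoffman_exp x = hoffman_init x"
  using assms unfolding antisym_space_def
proof (induction rule: tensor.span_induct_alt)
  case base
  then show ?case
    by (simp add: hoffman_exp_def hoffman_init_def)
next
  case (step c y z)
  then have "hoffman_exp y = hoffman_init y"
    using hoffman_exp_antisym by (auto simp: hoffman_exp_letter) (simp add: hoffman_init_def)
  with step show ?case
    by (simp add: hoffman_exp_def hoffman_init_def lin_ext.add lin_ext.scale)
qed

lemma quasi_half_shuffle_snoc_snoc:
  "quasi_half_shuffle (snoc x a) (snoc y b) = snoc (bilin_ext quasi_shuffle_word (snoc x a) y) b"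
  by (simp add: quasi_half_shuffle_def bilin_ext_snoc_right bilin_ext_snoc_left snoc_bilin_ext)

text \<open>The quasi half-shuffle is 0 when its left word is empty. For nonempty \<open>u\<close>
  this does not occur, since the last-block recursion makes every word on the left end with a
  letter.\<close>

lemma quasi_half_shuffle_hoffman_exp_word:
  assumes "u \<noteq> []"
  shows "quasi_half_shuffle (hoffman_exp_word u) (snoc y b) =
    snoc (bilin_ext quasi_shuffle_word (hoffman_exp_word u) y) b"
  unfolding hoffman_exp_word_last[OF assms] quasi_half_shuffle_def bilin_ext_sum_left
    bilin_ext_scale_left
  by (simp add: snoc.sum snoc.scale flip: quasi_half_shuffle_def quasi_half_shuffle_snoc_snoc)

text \<open>A half-shuffle ends with the last letter of \<open>v\<close>. Beneath it stands a full
  shuffle, on which \<open>hoffman_exp\<close> is multiplicative.\<close>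

lemma hoffman_init_half_shuffle_word:
  "hoffman_init (half_shuffle_word u v) =
    quasi_half_shuffle (hoffman_exp_word u) (hoffman_init (word v))"
proof (induction u v rule: half_shuffle_word.induct)
  case (1 v)
  have "quasi_half_shuffle (word []) y = 0" for y :: "('a, 'b) tensor"
    by (simp add: quasi_half_shuffle_def bilin_ext_word_left lin_ext_def)
  then show ?case
    by (simp add: hoffman_init_def)
next
  case (2 u a)
  then show ?case
    by (simp add: hoffman_init_def quasi_half_shuffle_def bilin_ext_zero_right)
next
  case (3 u a v b)
  have "hoffman_init (word (v @ [b]) :: ('a, 'b) tensor) = snoc (hoffman_exp_word v) b"
    by (simp add: hoffman_init_def)
  then show ?case
    by (simp add: hoffman_init_snoc hoffman_exp_shuffle_word quasi_half_shuffle_hoffman_exp_word)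
qed

lemma hoffman_init_half_shuffle:
  "hoffman_init (half_shuffle x y) = quasi_half_shuffle (hoffman_exp x) (hoffman_init y)"
proof -
  have "hoffman_init (half_shuffle x y) =
      bilin_ext (\<lambda>u v. hoffman_init (half_shuffle_word u v)) x y"
    by (simp add: hoffman_init_def half_shuffle_def lin_ext_bilin_ext)
  also have "\<dots> = bilin_ext (\<lambda>u v. quasi_half_shuffle (hoffman_exp_word u)
      (hoffman_init (word v))) x y"
    by (simp only: hoffman_init_half_shuffle_word)
  also have "\<dots> = quasi_half_shuffle (hoffman_exp x) (hoffman_init y)"
    by (simp add: quasi_half_shuffle_def hoffman_exp_def hoffman_init_def bilin_ext_lin_ext)
  finally show ?thesis .
qed

lemma hoffman_exp_area:
  assumes "x \<in> antisym_space" "y \<in> antisym_space"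
  shows "hoffman_exp (area x y) = discrete_area (hoffman_exp x) (hoffman_exp y)"
proof -
  have "hoffman_exp (area x y) = hoffman_init (area x y)"
    using assms by (intro hoffman_exp_eq_init area_in_antisym_space)
  also have "\<dots> = hoffman_init (half_shuffle x y) - hoffman_init (half_shuffle y x)"
    by (simp add: area_def hoffman_init_def lin_ext.diff)
  \<comment> \<open>In the two half-shuffles \<open>hoffman_init\<close> falls once on
    \<open>y\<close> and once on \<open>x\<close>, so both memberships are needed to return to
    \<open>hoffman_exp\<close>.\<close>
  also have "\<dots> = discrete_area (hoffman_exp x) (hoffman_exp y)"
    using assms by (simp add: hoffman_init_half_shuffle discrete_area_def hoffman_exp_eq_init)
  finally show ?thesis .
qed

section \<open>Passage to the levels and to the whole spaces\<close>

lemma hoffman_exp_span: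
  assumes "x \<in> tensor.span S" "\<And>y. y \<in> S \<Longrightarrow> hoffman_exp y \<in> tensor.span T"
  shows "hoffman_exp x \<in> tensor.span T"
proof -
  interpret Vector_Spaces.linear scale scale hoffman_exp by (rule linear_hoffman_exp)
  show ?thesis
    using assms(1) by (induction rule: tensor.span_induct_alt)
      (auto simp: zero add scale intro: tensor.span_zero tensor.span_add tensor.span_scale assms(2))
qed

text \<open>Letters are fixed, and areas of lower levels become discrete areas of images that lie in
  the same levels by induction.\<close>

lemma hoffman_exp_area_level:
  fixes x :: "('a, 'f::field_char_0) tensor"
  assumes "x \<in> area_level area n"
  shows "hoffman_exp x \<in> area_level discrete_area n"
  using assms
proof (induction n arbitrary: x rule: less_induct)
  case (less n)
  show ?case
  proof (cases n rule: nat_cases_2)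
    case 1
    then show ?thesis using less.prems by (simp add: hoffman_exp_def)
  next
    case 2
    show ?thesis
      using less.prems unfolding 2 area_level.simps
      by (rule hoffman_exp_span) (use hoffman_exp_letter in \<open>auto intro!: tensor.span_base\<close>)
  next
    case (3 k)
    show ?thesis
      using less.prems unfolding 3 area_level.simps
    proof (rule hoffman_exp_span, elim UN_E CollectE exE conjE)
      fix m and x y z :: "('a, 'f) tensor"
      assume m: "m \<in> {1..Suc k}" and z: "z = area x y"
        and x: "x \<in> area_level area (Suc (Suc k) - m)" and y: "y \<in> area_level area m"
      have "hoffman_exp z = discrete_area (hoffman_exp x) (hoffman_exp y)"
        unfolding z using x y area_level_subset_antisym_space by (intro hoffman_exp_area) blast+
      moreover have "hoffman_exp x \<in> area_level discrete_area (Suc (Suc k) - m)"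
        "hoffman_exp y \<in> area_level discrete_area m"
        using m x y 3 by (auto intro!: less.IH)
      ultimately show "hoffman_exp z \<in> tensor.span (\<Union>m\<in>{1..Suc k}. {discrete_area x y | x y.
          x \<in> area_level discrete_area (Suc (Suc k) - m) \<and> y \<in> area_level discrete_area m})"
        using m by (intro tensor.span_base) blast
    qed
  qed
qed

theorem theorem5p9:
  shows "(\<forall>\<phi> \<in> (D_space :: ('a::finite, 'f::field_char_0) tensor set).
            hoffman_exp \<phi> \<in> discrete_D_space)
       \<and> (\<forall>\<phi> \<in> (D_space :: ('a, 'f) tensor set). \<forall>\<psi> \<in> D_space.
            hoffman_exp (area \<phi> \<psi>) = discrete_area (hoffman_exp \<phi>) (hoffman_exp \<psi>))"
proof (intro conjI ballI)
  fix \<phi> :: "('a, 'f) tensor" assume "\<phi> \<in> D_space"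
  then show "hoffman_exp \<phi> \<in> discrete_D_space"
    unfolding D_space_def discrete_D_space_def area_space_def
    by (rule hoffman_exp_span) (auto intro!: tensor.span_base dest: hoffman_exp_area_level)
next
  fix \<phi> \<psi> :: "('a, 'f) tensor" assume "\<phi> \<in> D_space" "\<psi> \<in> D_space"
  then show "hoffman_exp (area \<phi> \<psi>) = discrete_area (hoffman_exp \<phi>) (hoffman_exp \<psi>)"
    using D_space_subset_antisym_space by (intro hoffman_exp_area) blast+
qed

end
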